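(* Let $U\subset\mathbb R^2$ be a domain. If $u\in C^2(U)$ is an $\infty$-harmonic function such that $Du\ne0$ and $\det D^2u\ne0$ in $U$, then $v=\frac12|Du|^2$ satisfies $$-\operatorname{div}\left(\frac{Dv}{|Dv|}\right)=\frac{|Dv|}{2v}\quad\text{in }U.$$ Geometrically, the mean curvature of the level set of $v$ (equivalently, of the gradient trajectory of $u$), given by $-\operatorname{div}(Dv/|Dv|)$, is $|D^2u\,Du|/|Du|^2$.
   Context: $u\in C^2(U)$ being $\infty$-harmonic means $\sum_{i,j}u_iu_ju_{ij}=0$ in $U$. $D^2u\,Du$ denotes the vector $(\sum_j u_{ij}u_j)_i$. It is known (Aronsson) that, under the hypotheses of the statement, $u$ is smooth. *)

theory Defs
  imports "HOL-Analysis.Analysis"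
begin

definition partial_deriv :: "'n::finite \<Rightarrow> (real^'n \<Rightarrow> real) \<Rightarrow> real^'n \<Rightarrow> real" where
  "partial_deriv i f x = frechet_derivative f (at x) (axis i 1)"

definition gradient :: "(real^'n::finite \<Rightarrow> real) \<Rightarrow> real^'n \<Rightarrow> real^'n" where
  "gradient f x = (\<chi> i. partial_deriv i f x)"

definition hessian :: "(real^'n::finite \<Rightarrow> real) \<Rightarrow> real^'n \<Rightarrow> real^'n^'n" where
  "hessian f x = (\<chi> i j. partial_deriv j (partial_deriv i f) x)"

definition divergence :: "(real^'n::finite \<Rightarrow> real^'n) \<Rightarrow> real^'n \<Rightarrow> real" where
  "divergence F x = (\<Sum>i\<in>UNIV. partial_deriv i (\<lambda>y. F y $ i) x)"

definition C1_on :: "(real^'n::finite) set \<Rightarrow> (real^'n \<Rightarrow> real) \<Rightarrow> bool" where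
  "C1_on U f \<longleftrightarrow> (\<forall>x\<in>U. f differentiable (at x)) \<and>
     (\<forall>i. continuous_on U (partial_deriv i f))"

definition C2_on :: "(real^'n::finite) set \<Rightarrow> (real^'n \<Rightarrow> real) \<Rightarrow> bool" where
  "C2_on U f \<longleftrightarrow> C1_on U f \<and> (\<forall>i. C1_on U (partial_deriv i f))"

definition infinity_harmonic_on :: "(real^'n::finite) set \<Rightarrow> (real^'n \<Rightarrow> real) \<Rightarrow> bool" where
  "infinity_harmonic_on U u \<longleftrightarrow>
     (\<forall>x\<in>U. (\<Sum>i\<in>UNIV. \<Sum>j\<in>UNIV.
        partial_deriv i u x * partial_deriv j u x * partial_deriv j (partial_deriv i u) x) = 0)"

definition unit_normal :: "(real^'n::finite \<Rightarrow> real) \<Rightarrow> real^'n \<Rightarrow> real^'n" where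
  "unit_normal v x = gradient v x /\<^sub>R norm (gradient v x)"

text \<open>Mean curvature of the level set of \<open>v\<close> through \<open>x\<close>, taken with respect to the unit
  normal \<open>Dv/|Dv|\<close> and not divided by the dimension of the level set.\<close>

definition level_set_mean_curvature :: "(real^'n::finite \<Rightarrow> real) \<Rightarrow> real^'n \<Rightarrow> real" where
  "level_set_mean_curvature v x = - divergence (unit_normal v) x"

definition gradient_trajectory ::
    "(real^'n::finite \<Rightarrow> real) \<Rightarrow> (real^'n) set \<Rightarrow> real set \<Rightarrow> (real \<Rightarrow> real^'n) \<Rightarrow> bool" where
  "gradient_trajectory u U I \<gamma> \<longleftrightarrow> open I \<and> is_interval I \<and>
     (\<forall>t\<in>I. \<gamma> t \<in> U \<and> (\<gamma> has_vector_derivative gradient u (\<gamma> t)) (at t))"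

definition unit_tangent :: "(real \<Rightarrow> real^'n::finite) \<Rightarrow> real \<Rightarrow> real^'n" where
  "unit_tangent \<gamma> t =
     vector_derivative \<gamma> (at t) /\<^sub>R norm (vector_derivative \<gamma> (at t))"

text \<open>The derivative of the unit tangent with respect to arc length.\<close>

definition curvature_vector :: "(real \<Rightarrow> real^'n::finite) \<Rightarrow> real \<Rightarrow> real^'n" where
  "curvature_vector \<gamma> t =
     vector_derivative (unit_tangent \<gamma>) (at t) /\<^sub>R norm (vector_derivative \<gamma> (at t))"

end

theory Submission
  imports Defs
begin

text \<open>
  Since \<open>Dv = D\<^sup>2u Du\<close>, the \<open>\<infinity>\<close>-Laplace equation says that \<open>Dv\<close> is orthogonal to \<open>Du\<close>
  (\<open>infinity_harmonic_on_orthogonal\<close>), and \<open>det D\<^sup>2u \<noteq> 0\<close> makes \<open>Dv\<close> nonzero. In the plane an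
  orthogonal direction is unique up to sign, so \<open>Dv/|Dv| = \<sigma> J Du/|Du|\<close>, where \<open>J\<close> is the rotation
  by a right angle and \<open>\<sigma> = \<plusminus>1\<close> is locally constant (\<open>unit_normal_locally_rot90\<close>). The right-hand
  side contains only first derivatives of \<open>u\<close>, so the unit normal of the level sets of \<open>v\<close> inherits
  differentiability from \<open>u \<in> C\<^sup>2\<close>.

  By the symmetry of \<open>D\<^sup>2u\<close> the field \<open>J Du\<close> is divergence free, so the divergence of the normal
  comes from the factor \<open>1/|Du|\<close> alone; it equals \<open>-|Dv|/|Du|\<^sup>2\<close> (\<open>unit_normal_divergence\<close>), and
  \<open>|Du|\<^sup>2 = 2 v\<close>.

  Along a gradient trajectory \<open>\<gamma>\<close> the orthogonality keeps \<open>v\<close>, and with it the speed \<open>|Du|\<close>,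
  constant. Differentiating the unit tangent \<open>Du/|Du|\<close> gives the curvature vector \<open>Dv/|Du|\<^sup>2\<close>
  (\<open>gradient_trajectory_curvature\<close>). Moreover \<open>u\<close> grows along \<open>\<gamma>\<close> at the constant rate \<open>|Du|\<^sup>2\<close>, so
  \<open>\<gamma>\<close> is a uniform motion along a coordinate line in the local coordinates \<open>(u, v)\<close>. This
  identifies the level sets of \<open>v\<close> with gradient trajectories
  (\<open>level_set_local_gradient_trajectory\<close>).
\<close>

section \<open>Gradients and Hessians\<close>

lemma has_derivative_gradient:
  fixes f :: "real^'n::finite \<Rightarrow> real"
  assumes "f differentiable (at x)"
  shows "(f has_derivative (\<lambda>h. gradient f x \<bullet> h)) (at x)"
proof -
  let ?D = "frechet_derivative f (at x)"
  have lin: "linear ?D"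
    using assms by (rule linear_frechet_derivative)
  have "?D h = gradient f x \<bullet> h" for h
  proof -
    have "h = (\<Sum>i\<in>UNIV. h $ i *\<^sub>R axis i 1)"
      using basis_expansion[of h] by (simp add: scalar_mult_eq_scaleR)
    then have "?D h = ?D (\<Sum>i\<in>UNIV. h $ i *\<^sub>R axis i 1)"
      by (rule arg_cong)
    also have "\<dots> = (\<Sum>i\<in>UNIV. h $ i * ?D (axis i 1))"
      by (simp add: linear_sum[OF lin] linear_cmul[OF lin])
    finally show ?thesis
      by (simp add: gradient_def partial_deriv_def inner_vec_def mult.commute)
  qed
  then show ?thesis
    using assms frechet_derivative_works by (metis (no_types, lifting) ext)
qed

lemma gradient_unique:
  assumes "(f has_derivative (\<lambda>h. g \<bullet> h)) (at x)"
  shows "gradient f x = g"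
  using frechet_derivative_at[OF assms, symmetric]
  by (simp add: gradient_def partial_deriv_def vec_eq_iff inner_axis)

lemma has_derivative_vecI:
  fixes f :: "'a::real_normed_vector \<Rightarrow> real^'n::finite"
  assumes "\<And>i. ((\<lambda>y. f y $ i) has_derivative (\<lambda>h. f' h $ i)) (at x)"
  shows "(f has_derivative f') (at x)"
proof (subst has_derivative_componentwise_within, intro ballI)
  fix b :: "real^'n" assume "b \<in> Basis"
  then obtain i where "b = axis i 1"
    by (auto simp: Basis_vec_def)
  then show "((\<lambda>y. f y \<bullet> b) has_derivative (\<lambda>h. f' h \<bullet> b)) (at x)"
    using assms[of i] by (simp add: inner_axis)
qed

lemma divergence_eq_trace:
  fixes F :: "real^'n::finite \<Rightarrow> real^'n"
  assumes "(F has_derivative F') (at x)"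
  shows "divergence F x = (\<Sum>i\<in>UNIV. F' (axis i 1) $ i)"
proof -
  have "((\<lambda>y. F y $ i) has_derivative (\<lambda>h. F' h $ i)) (at x)" for i
    using assms by (rule bounded_linear.has_derivative[OF bounded_linear_vec_nth])
  from frechet_derivative_at[OF this, symmetric] show ?thesis
    by (simp add: divergence_def partial_deriv_def)
qed

lemma continuous_on_matrix_vector_mult:
  fixes A :: "'a::topological_space \<Rightarrow> real^'n::finite^'m::finite"
  assumes "continuous_on S A" "continuous_on S w"
  shows "continuous_on S (\<lambda>y. A y *v w y)"
  unfolding matrix_vector_mult_def
  by (intro continuous_on_vec_lambda continuous_on_sum continuous_on_mult
      continuous_on_component assms)

lemma C2_on_differentiable:
  assumes "C2_on U u" "x \<in> U"
  shows "u differentiable (at x)" "partial_deriv i u differentiable (at x)"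
  using assms by (auto simp: C2_on_def C1_on_def)

lemma C2_on_continuous_gradient:
  assumes "C2_on U u"
  shows "continuous_on U (gradient u)"
  using assms unfolding gradient_def C2_on_def C1_on_def
  by (intro continuous_on_vec_lambda) auto

lemma C2_on_continuous_hessian:
  assumes "C2_on U u"
  shows "continuous_on U (hessian u)"
  using assms unfolding hessian_def C2_on_def C1_on_def
  by (intro continuous_on_vec_lambda) auto

lemma has_derivative_gradient_hessian:
  assumes "C2_on U u" "x \<in> U"
  shows "(gradient u has_derivative (\<lambda>h. hessian u x *v h)) (at x)"
proof (rule has_derivative_vecI)
  fix i
  have "(partial_deriv i u has_derivative (\<lambda>h. gradient (partial_deriv i u) x \<bullet> h)) (at x)"
    using C2_on_differentiable(2)[OF assms] by (rule has_derivative_gradient)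
  then show "((\<lambda>y. gradient u y $ i) has_derivative (\<lambda>h. (hessian u x *v h) $ i)) (at x)"
    by (simp add: gradient_def hessian_def matrix_vector_mult_def inner_vec_def)
qed

section \<open>Symmetry of second derivatives\<close>

lemma has_derivative_along_line:
  fixes f :: "real^'n::finite \<Rightarrow> real"
  assumes "f differentiable (at (a + s *\<^sub>R axis i 1))"
  shows "((\<lambda>s. f (a + s *\<^sub>R axis i 1)) has_real_derivative
           partial_deriv i f (a + s *\<^sub>R axis i 1)) (at s)"
proof -
  let ?p = "a + s *\<^sub>R axis i 1 :: real^'n"
  have "((\<lambda>s. a + s *\<^sub>R axis i 1) has_derivative (\<lambda>h. h *\<^sub>R axis i 1)) (at s)"
    by (auto intro!: derivative_eq_intros)
  from has_derivative_compose[OF this has_derivative_gradient[OF assms]]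
  have "((\<lambda>s. f (a + s *\<^sub>R axis i 1)) has_derivative
          (\<lambda>h. gradient f ?p \<bullet> (h *\<^sub>R axis i 1))) (at s)" .
  moreover have "(\<lambda>h. gradient f ?p \<bullet> (h *\<^sub>R axis i 1)) = (*) (partial_deriv i f ?p)"
    by (simp add: fun_eq_iff inner_axis gradient_def)
  ultimately show ?thesis
    by (simp only: has_field_derivative_def)
qed

text \<open>The mean value theorem is used first for the difference quotient in direction \<open>i\<close>, as a function
  of the step in that direction, and then for \<open>partial_deriv i f\<close> in direction \<open>j\<close>. The left-hand
  side is symmetric in \<open>i\<close> and \<open>j\<close>, while the right-hand side records the order of
  differentiation; this is what makes mixed partials commute.\<close>

lemma second_difference_eq_mixed_partial:
  fixes f :: "real^'n::finite \<Rightarrow> real"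
  assumes "0 < h"
    and f: "\<And>y. dist x y \<le> 2 * h \<Longrightarrow> f differentiable (at y)"
    and fi: "\<And>y. dist x y \<le> 2 * h \<Longrightarrow> partial_deriv i f differentiable (at y)"
  obtains p where "dist x p \<le> 2 * h"
    and "f (x + h *\<^sub>R axis i 1 + h *\<^sub>R axis j 1) - f (x + h *\<^sub>R axis i 1)
         - f (x + h *\<^sub>R axis j 1) + f x = h\<^sup>2 * partial_deriv j (partial_deriv i f) p"
proof -
  let ?i = "axis i 1 :: real^'n" and ?j = "axis j 1 :: real^'n"
  have near: "dist x (x + s *\<^sub>R ?i + t *\<^sub>R ?j) \<le> 2 * h" if "0 \<le> s" "s \<le> h" "0 \<le> t" "t \<le> h" for s t
  proof -
    have "norm (s *\<^sub>R ?i + t *\<^sub>R ?j) \<le> s + t"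
      using norm_triangle_ineq[of "s *\<^sub>R ?i" "t *\<^sub>R ?j"] that by simp
    moreover have "dist x (x + s *\<^sub>R ?i + t *\<^sub>R ?j) = norm (s *\<^sub>R ?i + t *\<^sub>R ?j)"
      by (metis add.assoc add_diff_cancel_left' dist_commute dist_norm)
    ultimately show ?thesis
      using that by simp
  qed
  let ?\<phi> = "\<lambda>s. f (x + h *\<^sub>R ?j + s *\<^sub>R ?i) - f (x + s *\<^sub>R ?i)"
  let ?\<phi>' = "\<lambda>s. partial_deriv i f (x + h *\<^sub>R ?j + s *\<^sub>R ?i) - partial_deriv i f (x + s *\<^sub>R ?i)"
  have "(?\<phi> has_real_derivative ?\<phi>' s) (at s)" if "0 \<le> s" "s \<le> h" for s
    using near[of s h] near[of s 0] that \<open>0 < h\<close>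
    by (intro DERIV_diff has_derivative_along_line f) (auto simp: algebra_simps)
  from MVT2[OF \<open>0 < h\<close>, of ?\<phi> ?\<phi>'] this obtain s where s: "0 < s" "s < h"
    and \<phi>: "?\<phi> h - ?\<phi> 0 = (h - 0) * ?\<phi>' s"
    by blast
  let ?\<psi> = "\<lambda>t. partial_deriv i f (x + s *\<^sub>R ?i + t *\<^sub>R ?j)"
  let ?\<psi>' = "\<lambda>t. partial_deriv j (partial_deriv i f) (x + s *\<^sub>R ?i + t *\<^sub>R ?j)"
  have "(?\<psi> has_real_derivative ?\<psi>' t) (at t)" if "0 \<le> t" "t \<le> h" for t
    using near[of s t] that s by (intro has_derivative_along_line fi) auto
  from MVT2[OF \<open>0 < h\<close>, of ?\<psi> ?\<psi>'] this obtain t where t: "0 < t" "t < h"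
    and \<psi>: "?\<psi> h - ?\<psi> 0 = (h - 0) * ?\<psi>' t"
    by blast
  show thesis
  proof
    show "dist x (x + s *\<^sub>R ?i + t *\<^sub>R ?j) \<le> 2 * h"
      using near s t by simp
    have "?\<phi> h - ?\<phi> 0 = h * (h * ?\<psi>' t)"
      using \<phi> \<psi> by (simp add: algebra_simps)
    then show "f (x + h *\<^sub>R ?i + h *\<^sub>R ?j) - f (x + h *\<^sub>R ?i) - f (x + h *\<^sub>R ?j) + f x
         = h\<^sup>2 * ?\<psi>' t"
      by (simp add: algebra_simps power2_eq_square)
  qed
qed

text \<open>Both mixed partials arise as limits of the same second difference divided by \<open>h\<^sup>2\<close>: its two
  evaluations, with the roles of \<open>i\<close> and \<open>j\<close> exchanged, give points \<open>p\<close> and \<open>q\<close> close to \<open>x\<close> where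
  the two mixed partials agree, and continuity transports the equality to \<open>x\<close>.\<close>

lemma C2_on_mixed_partials_commute:
  fixes f :: "real^'n::finite \<Rightarrow> real"
  assumes "open U" "C2_on U f" "x \<in> U"
  shows "partial_deriv j (partial_deriv i f) x = partial_deriv i (partial_deriv j f) x"
proof -
  let ?D = "\<lambda>i j. partial_deriv j (partial_deriv i f)"
  have lim: "(?D i j \<longlongrightarrow> ?D i j x) (nhds x)" for i j
    using assms unfolding C2_on_def C1_on_def
    by (metis continuous_on_eq_continuous_at continuous_at tendsto_at_iff_tendsto_nhds)
  have "\<bar>?D i j x - ?D j i x\<bar> < e" if "0 < e" for e
  proof -
    have "\<forall>\<^sub>F y in nhds x. dist (?D i j y) (?D i j x) < e/2 \<and> dist (?D j i y) (?D j i x) < e/2"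
      using lim[of i j, THEN tendstoD, of "e/2"] lim[of j i, THEN tendstoD, of "e/2"] that
      by (simp add: eventually_conj)
    moreover have "\<forall>\<^sub>F y in nhds x. y \<in> U"
      using assms by (simp add: eventually_nhds_in_open)
    ultimately have "\<forall>\<^sub>F y in nhds x. y \<in> U \<and> dist (?D i j y) (?D i j x) < e/2 \<and>
        dist (?D j i y) (?D j i x) < e/2"
      by (simp add: eventually_conj)
    then obtain r where "0 < r" and r: "\<And>y. dist x y < r \<Longrightarrow>
        y \<in> U \<and> dist (?D i j y) (?D i j x) < e/2 \<and> dist (?D j i y) (?D j i x) < e/2"
      unfolding eventually_nhds_metric dist_commute[of x] by blast
    define h where "h = r / 3"
    have "0 < h" and U: "\<And>y. dist x y \<le> 2 * h \<Longrightarrow> y \<in> U"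
      and h: "\<And>y. dist x y \<le> 2 * h \<Longrightarrow> dist x y < r"
      using \<open>0 < r\<close> r by (auto simp: h_def)
    obtain p where p: "dist x p \<le> 2 * h" "f (x + h *\<^sub>R axis i 1 + h *\<^sub>R axis j 1)
        - f (x + h *\<^sub>R axis i 1) - f (x + h *\<^sub>R axis j 1) + f x = h\<^sup>2 * ?D i j p"
      using second_difference_eq_mixed_partial[OF \<open>0 < h\<close>, of x f i j] U C2_on_differentiable[OF assms(2)]
      by metis
    obtain q where q: "dist x q \<le> 2 * h" "f (x + h *\<^sub>R axis j 1 + h *\<^sub>R axis i 1)
        - f (x + h *\<^sub>R axis j 1) - f (x + h *\<^sub>R axis i 1) + f x = h\<^sup>2 * ?D j i q"
      using second_difference_eq_mixed_partial[OF \<open>0 < h\<close>, of x f j i] U C2_on_differentiable[OF assms(2)]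
      by metis
    have "h\<^sup>2 * ?D i j p = h\<^sup>2 * ?D j i q"
      unfolding p(2)[symmetric] q(2)[symmetric] by (simp add: algebra_simps)
    with \<open>0 < h\<close> have "?D i j p = ?D j i q"
      by simp
    moreover have "\<bar>?D i j p - ?D i j x\<bar> < e/2" "\<bar>?D j i q - ?D j i x\<bar> < e/2"
      using r[OF h[OF p(1)]] r[OF h[OF q(1)]] unfolding dist_real_def by blast+
    ultimately show ?thesis
      by linarith
  qed
  then have "\<bar>?D i j x - ?D j i x\<bar> \<le> 0"
    by (meson less_irrefl not_le)
  then show ?thesis
    by simp
qed

lemma C2_on_hessian_symmetric:
  assumes "open U" "C2_on U u" "x \<in> U"
  shows "transpose (hessian u x) = hessian u x"
  using C2_on_mixed_partials_commute[OF assms] by (simp add: transpose_def hessian_def vec_eq_iff)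

lemma C2_on_hessian_self_adjoint:
  assumes "open U" "C2_on U u" "x \<in> U"
  shows "(hessian u x *v h) \<bullet> k = (hessian u x *v k) \<bullet> h"
  using C2_on_hessian_symmetric[OF assms]
  by (metis dot_lmul_matrix inner_commute transpose_matrix_vector)

section \<open>The function \<open>|Du|\<^sup>2/2\<close>\<close>

text \<open>Differentiating \<open>Du \<bullet> Du / 2\<close> puts the transpose of the Hessian in front of \<open>Du\<close>; the symmetry
  of second derivatives removes the transpose.\<close>

lemma has_derivative_half_norm_gradient:
  assumes "open U" "C2_on U u" "x \<in> U"
  shows "((\<lambda>y. (norm (gradient u y))\<^sup>2 / 2) has_derivative
           (\<lambda>h. (hessian u x *v gradient u x) \<bullet> h)) (at x)"
proof -
  have "((\<lambda>y. (gradient u y \<bullet> gradient u y) / 2) has_derivative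
           (\<lambda>h. gradient u x \<bullet> (hessian u x *v h))) (at x)"
    by (rule derivative_eq_intros has_derivative_gradient_hessian[OF assms(2,3)] refl
        | simp add: inner_commute)+
  moreover have "gradient u x \<bullet> (hessian u x *v h) = (hessian u x *v gradient u x) \<bullet> h" for h
    using C2_on_hessian_self_adjoint[OF assms] by (simp add: inner_commute)
  ultimately show ?thesis
    by (simp add: power2_norm_eq_inner)
qed

lemma gradient_half_norm_gradient:
  assumes "open U" "C2_on U u" "x \<in> U"
  shows "gradient (\<lambda>y. (norm (gradient u y))\<^sup>2 / 2) x = hessian u x *v gradient u x"
  using has_derivative_half_norm_gradient[OF assms] by (rule gradient_unique)

text \<open>The \<open>\<infinity>\<close>-Laplace equation says that, for \<open>C\<^sup>2\<close> functions, \<open>|Du|\<^sup>2/2\<close> has derivative zero in the direction \<open>Du\<close>.\<close>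

lemma infinity_harmonic_on_orthogonal:
  assumes "infinity_harmonic_on U u" "x \<in> U"
  shows "gradient u x \<bullet> (hessian u x *v gradient u x) = 0"
  using assms unfolding infinity_harmonic_on_def
  by (auto simp: inner_vec_def gradient_def hessian_def matrix_vector_mult_def sum_distrib_left mult_ac)

section \<open>Orthogonal vectors in the plane\<close>

definition rot90 :: "real^2 \<Rightarrow> real^2" where
  "rot90 w = vector [- w $ 2, w $ 1]"

lemma rot90_nth [simp]: "rot90 w $ 1 = - w $ 2" "rot90 w $ 2 = w $ 1"
  by (simp_all add: rot90_def)

lemma bounded_linear_rot90: "bounded_linear rot90"
  unfolding linear_conv_bounded_linear[symmetric] by (rule linearI) (simp_all add: vec_eq_iff forall_2)

lemma norm_rot90 [simp]: "norm (rot90 w) = norm w"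
  by (simp add: norm_eq_sqrt_inner inner_vec_def sum_2 add.commute)

text \<open>In the plane the orthogonal complement of \<open>a \<noteq> 0\<close> is the line spanned by \<open>rot90 a\<close>. Multiplying
  by \<open>(norm a)\<^sup>2\<close> keeps the expansion of \<open>b\<close> along that line free of divisions, so that it also
  covers \<open>a = 0\<close>.\<close>

lemma orthogonal_plane_eq_rot90:
  fixes a b :: "real^2"
  assumes "a \<bullet> b = 0"
  shows "(norm a)\<^sup>2 *\<^sub>R b = (b \<bullet> rot90 a) *\<^sub>R rot90 a"
proof -
  have 0: "a$1 * b$1 + a$2 * b$2 = 0"
    using assms by (simp add: inner_vec_def sum_2)
  have "(a$1 * a$1 + a$2 * a$2) * b$1 = (b$1 * (- a$2) + b$2 * a$1) * (- a$2)"
    using 0 by algebra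
  moreover have "(a$1 * a$1 + a$2 * a$2) * b$2 = (b$1 * (- a$2) + b$2 * a$1) * a$1"
    using 0 by algebra
  ultimately show ?thesis
    by (simp add: vec_eq_iff forall_2 power2_norm_eq_inner inner_vec_def sum_2)
qed

text \<open>Normalising \<open>b\<close> forgets everything about it except the side of \<open>a\<close> on which it lies. This trades
  a unit normal \<open>Dv/|Dv|\<close>, in which second derivatives of \<open>u\<close> occur, for one in which only \<open>Du\<close> and
  a sign occur.\<close>

lemma normalised_orthogonal_plane:
  fixes a b :: "real^2"
  assumes "a \<bullet> b = 0" "a \<noteq> 0" "b \<noteq> 0"
  shows "\<bar>b \<bullet> rot90 a\<bar> = norm a * norm b"
    and "b /\<^sub>R norm b = (sgn (b \<bullet> rot90 a) * inverse (norm a)) *\<^sub>R rot90 a"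
proof -
  define \<alpha> \<beta> q where "\<alpha> = norm a" and "\<beta> = norm b" and "q = b \<bullet> rot90 a"
  have pos: "\<alpha> > 0" "\<beta> > 0"
    using assms by (simp_all add: \<alpha>_def \<beta>_def)
  have eq: "\<alpha>\<^sup>2 *\<^sub>R b = q *\<^sub>R rot90 a"
    using orthogonal_plane_eq_rot90[OF assms(1)] by (simp add: \<alpha>_def q_def)
  from arg_cong[OF this, of norm] have "\<alpha> * (\<alpha> * \<beta>) = \<alpha> * \<bar>q\<bar>"
    by (simp add: power2_eq_square mult_ac flip: \<alpha>_def \<beta>_def)
  with pos have abs: "\<bar>q\<bar> = \<alpha> * \<beta>"
    by simp
  then show "\<bar>b \<bullet> rot90 a\<bar> = norm a * norm b"
    by (simp only: \<alpha>_def \<beta>_def q_def)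
  have "b /\<^sub>R \<beta> = inverse (\<alpha>\<^sup>2 * \<beta>) *\<^sub>R (\<alpha>\<^sup>2 *\<^sub>R b)"
    using pos by simp
  also have "\<dots> = (inverse (\<alpha>\<^sup>2 * \<beta>) * q) *\<^sub>R rot90 a"
    unfolding eq by simp
  also have "inverse (\<alpha>\<^sup>2 * \<beta>) * q = inverse (\<alpha>\<^sup>2 * \<beta>) * (sgn q * (\<alpha> * \<beta>))"
    by (metis abs sgn_mult_abs)
  also have "\<dots> = sgn q * inverse \<alpha>"
    using pos by (simp add: power2_eq_square field_simps)
  finally show "b /\<^sub>R norm b = (sgn (b \<bullet> rot90 a) * inverse (norm a)) *\<^sub>R rot90 a"
    by (simp only: \<alpha>_def \<beta>_def q_def)
qed

lemma orthogonal_basis_plane_eq_0: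
  fixes a b h :: "real^2"
  assumes "a \<bullet> b = 0" "a \<noteq> 0" "b \<noteq> 0" and h: "a \<bullet> h = 0" "b \<bullet> h = 0"
  shows "h = 0"
proof -
  have "0 = ((norm a)\<^sup>2 *\<^sub>R b) \<bullet> h"
    using h by simp
  also have "\<dots> = (b \<bullet> rot90 a) * (h \<bullet> rot90 a)"
    unfolding orthogonal_plane_eq_rot90[OF assms(1)] by (simp add: inner_commute)
  finally have "h \<bullet> rot90 a = 0"
    using normalised_orthogonal_plane(1)[OF assms(1-3)] assms(2,3) by auto
  with orthogonal_plane_eq_rot90[OF h(1)] show ?thesis
    using assms(2) by simp
qed

text \<open>For a Hessian \<open>H = D\<^sup>2u\<close> this says that the rotated gradient of \<open>u\<close> is divergence free.\<close>

lemma trace_rot90_symmetric: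
  fixes H :: "real^2^2"
  assumes "transpose H = H"
  shows "(\<Sum>i\<in>UNIV. rot90 (H *v axis i 1) $ i) = 0"
proof -
  have "H $ 1 $ 2 = transpose H $ 2 $ 1"
    by (simp add: transpose_def)
  with assms have "H $ 1 $ 2 = H $ 2 $ 1"
    by simp
  then show ?thesis
    by (simp add: sum_2 matrix_vector_mul_component inner_axis)
qed

section \<open>The normal field and its divergence\<close>

text \<open>The sign in \<open>Dv/|Dv| = \<plusminus> rot90 Du/|Du|\<close> is the sign of \<open>Dv \<bullet> rot90 Du\<close>, which is continuous and
  vanishes nowhere, because \<open>Dv\<close> is a nonzero multiple of \<open>rot90 Du\<close>. Hence it is locally
  constant.\<close>

lemma unit_normal_locally_rot90:
  fixes u v :: "real^2 \<Rightarrow> real"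
  assumes "open U" "continuous_on U (gradient u)" "continuous_on U (gradient v)"
    and orth: "\<And>y. y \<in> U \<Longrightarrow> gradient u y \<bullet> gradient v y = 0"
    and nz: "\<And>y. y \<in> U \<Longrightarrow> gradient u y \<noteq> 0" "\<And>y. y \<in> U \<Longrightarrow> gradient v y \<noteq> 0"
    and "x \<in> U"
  obtains W where "open W" "x \<in> W" "W \<subseteq> U"
    and "\<And>y. y \<in> W \<Longrightarrow> unit_normal v y
           = (sgn (gradient v x \<bullet> rot90 (gradient u x)) * inverse (norm (gradient u y)))
               *\<^sub>R rot90 (gradient u y)"
proof -
  define q where "q = (\<lambda>y. gradient v y \<bullet> rot90 (gradient u y))"
  have q: "continuous_on U q"
    unfolding q_def
    by (rule continuous_on_inner[OF assms(3) bounded_linear.continuous_on[OF bounded_linear_rot90 assms(2)]])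
  define W where "W = {y\<in>U. 0 < sgn (q x) * q y}"
  have "q x \<noteq> 0"
    using normalised_orthogonal_plane(1)[OF orth nz, OF \<open>x \<in> U\<close> \<open>x \<in> U\<close> \<open>x \<in> U\<close>]
      nz[OF \<open>x \<in> U\<close>] by (auto simp: q_def)
  show thesis
  proof
    have "W = U \<inter> (\<lambda>y. sgn (q x) * q y) -` {0<..}"
      by (auto simp: W_def)
    then show "open W"
      by (simp add: continuous_open_preimage q continuous_on_mult_left \<open>open U\<close>)
    show "x \<in> W"
      using \<open>x \<in> U\<close> \<open>q x \<noteq> 0\<close> by (simp add: W_def zero_less_mult_iff sgn_if)
    show "W \<subseteq> U"
      by (auto simp: W_def)
    fix y assume "y \<in> W"
    then have "y \<in> U" and "sgn (q y) = sgn (q x)"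
      by (auto simp: W_def sgn_if zero_less_mult_iff split: if_splits)
    then show "unit_normal v y = (sgn (gradient v x \<bullet> rot90 (gradient u x))
        * inverse (norm (gradient u y))) *\<^sub>R rot90 (gradient u y)"
      unfolding unit_normal_def
      using normalised_orthogonal_plane(2)[OF orth nz, OF \<open>y \<in> U\<close> \<open>y \<in> U\<close> \<open>y \<in> U\<close>]
      by (simp add: q_def)
  qed
qed

text \<open>Near \<open>x\<close> the normal is \<open>\<sigma> rot90 Du/|Du|\<close> with a constant sign \<open>\<sigma>\<close>. Since \<open>rot90 Du\<close> is divergence
  free, only the derivative of \<open>1/|Du|\<close>, which is \<open>-Dv/|Du|\<^sup>3\<close>, contributes, and the divergence is
  \<open>-\<sigma> (Dv \<bullet> rot90 Du)/|Du|\<^sup>3 = -|Dv|/|Du|\<^sup>2\<close>.\<close>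

lemma unit_normal_divergence:
  fixes u v :: "real^2 \<Rightarrow> real"
  assumes "open U" "C2_on U u" "infinity_harmonic_on U u"
    and Du: "\<And>x. x \<in> U \<Longrightarrow> gradient u x \<noteq> 0"
    and v: "v = (\<lambda>x. (norm (gradient u x))\<^sup>2 / 2)"
    and Dv: "\<And>x. x \<in> U \<Longrightarrow> gradient v x \<noteq> 0"
    and "x \<in> U"
  shows "unit_normal v differentiable (at x)"
    and "divergence (unit_normal v) x = - (norm (gradient v x) / (norm (gradient u x))\<^sup>2)"
proof -
  have Dv_eq: "gradient v y = hessian u y *v gradient u y" if "y \<in> U" for y
    unfolding v using gradient_half_norm_gradient[OF assms(1,2) that] .
  have orth: "gradient u y \<bullet> gradient v y = 0" if "y \<in> U" for y
    using infinity_harmonic_on_orthogonal[OF assms(3) that] Dv_eq[OF that] by simp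
  have "continuous_on U (\<lambda>y. hessian u y *v gradient u y)"
    by (rule continuous_on_matrix_vector_mult[OF C2_on_continuous_hessian C2_on_continuous_gradient, OF assms(2,2)])
  then have contv: "continuous_on U (gradient v)"
    by (simp add: Dv_eq cong: continuous_on_cong)
  define q where "q = gradient v x \<bullet> rot90 (gradient u x)"
  obtain W where W: "open W" "x \<in> W" "W \<subseteq> U"
    and n: "\<And>y. y \<in> W \<Longrightarrow> unit_normal v y
           = (sgn q * inverse (norm (gradient u y))) *\<^sub>R rot90 (gradient u y)"
    unfolding q_def
    using unit_normal_locally_rot90[OF assms(1) C2_on_continuous_gradient[OF assms(2)] contv orth Du Dv \<open>x \<in> U\<close>]
    by blast
  let ?a = "gradient u x" and ?H = "hessian u x"
  have inv: "((\<lambda>y. inverse (norm (gradient u y))) has_derivative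
      (\<lambda>h. - (gradient v x \<bullet> h) / norm ?a ^ 3)) (at x)"
  proof -
    have "(gradient u has_derivative (\<lambda>h. ?H *v h)) (at x)"
      by (rule has_derivative_gradient_hessian[OF assms(2) \<open>x \<in> U\<close>])
    then have "((\<lambda>y. norm (gradient u y)) has_derivative (\<lambda>h. (?H *v h) \<bullet> sgn ?a)) (at x)"
      by (rule has_derivative_compose) (rule has_derivative_norm[OF Du[OF \<open>x \<in> U\<close>]])
    then have "((\<lambda>y. inverse (norm (gradient u y))) has_derivative
        (\<lambda>h. - (inverse (norm ?a) * ((?H *v h) \<bullet> sgn ?a) * inverse (norm ?a)))) (at x)"
      by (rule Deriv.has_derivative_inverse[rotated]) (simp add: Du \<open>x \<in> U\<close>)
    moreover have "(?H *v h) \<bullet> ?a = gradient v x \<bullet> h" for h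
      unfolding Dv_eq[OF \<open>x \<in> U\<close>] by (rule C2_on_hessian_self_adjoint[OF assms(1,2) \<open>x \<in> U\<close>])
    ultimately show ?thesis
      by (simp add: sgn_div_norm power3_eq_cube divide_simps)
  qed
  have rot: "((\<lambda>y. rot90 (gradient u y)) has_derivative (\<lambda>h. rot90 (?H *v h))) (at x)"
    using bounded_linear.has_derivative[OF bounded_linear_rot90
        has_derivative_gradient_hessian[OF assms(2) \<open>x \<in> U\<close>]] .
  (* The product rule for sigma/|Du| times rot90 Du; its trace is the divergence. *)
  let ?n' = "\<lambda>h. (sgn q * inverse (norm ?a)) *\<^sub>R rot90 (?H *v h)
      + (sgn q * (- (gradient v x \<bullet> h) / norm ?a ^ 3)) *\<^sub>R rot90 ?a"
  have "((\<lambda>y. (sgn q * inverse (norm (gradient u y))) *\<^sub>R rot90 (gradient u y)) has_derivative ?n') (at x)"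
    by (rule has_derivative_scaleR has_derivative_mult_right inv rot)+
  then have n': "(unit_normal v has_derivative ?n') (at x)"
    by (rule has_derivative_transform_within_open[OF _ W(1,2)]) (simp add: n)
  then show "unit_normal v differentiable (at x)"
    by (auto simp: differentiable_def)
  have "divergence (unit_normal v) x
      = (sgn q * inverse (norm ?a)) * (\<Sum>i\<in>UNIV. rot90 (?H *v axis i 1) $ i)
        - sgn q / norm ?a ^ 3 * (\<Sum>i\<in>UNIV. gradient v x $ i * rot90 ?a $ i)"
    unfolding divergence_eq_trace[OF n']
    by (simp add: inner_axis sum_2 algebra_simps add_divide_distrib diff_divide_distrib)
  also have "(\<Sum>i\<in>UNIV. gradient v x $ i * rot90 ?a $ i) = q"
    by (simp add: q_def inner_vec_def)
  also have "(\<Sum>i\<in>UNIV. rot90 (?H *v axis i 1) $ i) = 0"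
    using trace_rot90_symmetric C2_on_hessian_symmetric[OF assms(1,2) \<open>x \<in> U\<close>] by blast
  also have "sgn q / norm ?a ^ 3 * q = \<bar>q\<bar> / norm ?a ^ 3"
    by (simp add: abs_sgn)
  also have "\<bar>q\<bar> = norm ?a * norm (gradient v x)"
    unfolding q_def using normalised_orthogonal_plane(1)[OF orth Du Dv] \<open>x \<in> U\<close> by blast
  finally show "divergence (unit_normal v) x = - (norm (gradient v x) / (norm ?a)\<^sup>2)"
    using Du[OF \<open>x \<in> U\<close>] by (simp add: power3_eq_cube power2_eq_square)
qed

section \<open>Gradient trajectories\<close>

lemma gradient_trajectory_constant:
  fixes u v :: "real^'n::finite \<Rightarrow> real"
  assumes tr: "gradient_trajectory u U I \<gamma>"
    and v: "\<And>y. y \<in> U \<Longrightarrow> v differentiable (at y)"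
    and orth: "\<And>y. y \<in> U \<Longrightarrow> gradient v y \<bullet> gradient u y = 0"
    and "s \<in> I" "t \<in> I"
  shows "v (\<gamma> s) = v (\<gamma> t)"
proof (rule has_derivative_zero_unique_connected[of I "\<lambda>t. v (\<gamma> t)"])
  show "open I" "connected I"
    using tr by (auto simp: gradient_trajectory_def is_interval_connected)
  fix r assume "r \<in> I"
  then have "\<gamma> r \<in> U" and "(\<gamma> has_derivative (\<lambda>h. h *\<^sub>R gradient u (\<gamma> r))) (at r)"
    using tr by (auto simp: gradient_trajectory_def has_vector_derivative_def)
  from has_derivative_compose[OF this(2) has_derivative_gradient[OF v[OF this(1)]]]
  show "((\<lambda>t. v (\<gamma> t)) has_derivative (\<lambda>h. 0)) (at r)"
    by (simp add: orth \<open>\<gamma> r \<in> U\<close>)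
qed fact+

text \<open>Along a trajectory of constant speed \<open>c = |Du|\<close> the unit tangent is \<open>Du/c\<close>, whose time derivative
  is \<open>D\<^sup>2u Du/c\<close>. Passing from time to arc length contributes the second factor \<open>1/c\<close>.\<close>

lemma gradient_trajectory_curvature:
  fixes u :: "real^'n::finite \<Rightarrow> real"
  assumes tr: "gradient_trajectory u U I \<gamma>" and "C2_on U u"
    and const: "\<And>s t. s \<in> I \<Longrightarrow> t \<in> I \<Longrightarrow> norm (gradient u (\<gamma> s)) = norm (gradient u (\<gamma> t))"
    and "t \<in> I"
  shows "unit_tangent \<gamma> differentiable (at t)"
    and "curvature_vector \<gamma> t
      = (hessian u (\<gamma> t) *v gradient u (\<gamma> t)) /\<^sub>R (norm (gradient u (\<gamma> t)))\<^sup>2"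
proof -
  let ?c = "norm (gradient u (\<gamma> t))" and ?w = "hessian u (\<gamma> t) *v gradient u (\<gamma> t)"
  have "open I" and U: "\<And>s. s \<in> I \<Longrightarrow> \<gamma> s \<in> U"
    and \<gamma>: "\<And>s. s \<in> I \<Longrightarrow> (\<gamma> has_vector_derivative gradient u (\<gamma> s)) (at s)"
    using tr by (auto simp: gradient_trajectory_def)
  from \<gamma> have vd: "vector_derivative \<gamma> (at s) = gradient u (\<gamma> s)" if "s \<in> I" for s
    using that by (simp add: vector_derivative_at)
  have "((\<lambda>s. gradient u (\<gamma> s)) has_vector_derivative ?w) (at t)"
    using has_derivative_compose[OF \<gamma>[OF \<open>t \<in> I\<close>, unfolded has_vector_derivative_def]
        has_derivative_gradient_hessian[OF assms(2) U[OF \<open>t \<in> I\<close>]]]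
    by (simp add: has_vector_derivative_def matrix_vector_mult_scaleR)
  then have "((\<lambda>s. gradient u (\<gamma> s) /\<^sub>R ?c) has_vector_derivative ?w /\<^sub>R ?c) (at t)"
    by (rule bounded_linear.has_vector_derivative[OF bounded_linear_scaleR_right])
  then have T: "(unit_tangent \<gamma> has_vector_derivative ?w /\<^sub>R ?c) (at t)"
    by (rule has_vector_derivative_transform_within_open[OF _ \<open>open I\<close> \<open>t \<in> I\<close>])
      (simp add: unit_tangent_def vd const[OF _ \<open>t \<in> I\<close>])
  then show "unit_tangent \<gamma> differentiable (at t)"
    by (auto simp: has_vector_derivative_def differentiable_def)
  show "curvature_vector \<gamma> t = ?w /\<^sub>R ?c\<^sup>2"
    unfolding curvature_vector_def vector_derivative_at[OF T] vd[OF \<open>t \<in> I\<close>]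
    by (simp add: power2_eq_square)
qed

text \<open>In the coordinates \<open>F = (u, v)\<close>, which are admissible near \<open>x\<close> because \<open>Du\<close> and \<open>Dv\<close> are
  independent, a level set of \<open>v\<close> is a horizontal line. A gradient trajectory of \<open>u\<close> runs along such a
  line with speed \<open>|Du|\<^sup>2 = 2 v\<close>, which is constant there. So the trajectory through \<open>x\<close> is the
  preimage of a uniform motion under \<open>F\<close>: the inverse function theorem solves the differential
  equation.\<close>

lemma level_set_local_gradient_trajectory:
  fixes u v :: "real^2 \<Rightarrow> real"
  assumes "open U" "x \<in> U"
    and u: "\<And>y. y \<in> U \<Longrightarrow> u differentiable (at y)" "continuous_on U (gradient u)"
    and v: "\<And>y. y \<in> U \<Longrightarrow> v differentiable (at y)" "continuous_on U (gradient v)"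
    and orth: "\<And>y. y \<in> U \<Longrightarrow> gradient u y \<bullet> gradient v y = 0"
    and nz: "gradient u x \<noteq> 0" "gradient v x \<noteq> 0"
    and vu: "\<And>y. v y = (norm (gradient u y))\<^sup>2 / 2"
  obtains W I \<gamma> where "open W" "x \<in> W" "W \<subseteq> U"
    and "gradient_trajectory u U I \<gamma>" "0 \<in> I" "\<gamma> 0 = x"
    and "{y\<in>W. v y = v x} = \<gamma> ` I"
proof -
  let ?e = "axis 1 1 :: real^2" and ?e' = "axis 2 1 :: real^2"
  define F where "F = (\<lambda>y. u y *\<^sub>R ?e + v y *\<^sub>R ?e')"
  define L where "L = (\<lambda>y h. (gradient u y \<bullet> h) *\<^sub>R ?e + (gradient v y \<bullet> h) *\<^sub>R ?e')"
  have F_nth: "F y $ 1 = u y" "F y $ 2 = v y" for y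
    by (simp_all add: F_def axis_def)
  have L_nth: "L y h $ 1 = gradient u y \<bullet> h" "L y h $ 2 = gradient v y \<bullet> h" for y h
    by (simp_all add: L_def axis_def)
  have bl: "bounded_linear (L y)" for y
    unfolding L_def
    by (intro bounded_linear_add bounded_linear_scaleR_const bounded_linear_inner_right)
  then have bl_apply: "blinfun_apply (Blinfun (L y)) = L y" for y
    by (rule bounded_linear_Blinfun_apply)
  have derF: "(F has_derivative blinfun_apply (Blinfun (L y))) (at y)" if "y \<in> U" for y
    unfolding bl_apply unfolding F_def L_def
    by (intro has_derivative_add has_derivative_scaleR_left has_derivative_gradient u v that)
  have contL: "continuous_on U (\<lambda>y. Blinfun (L y))"
  proof (rule continuous_on_blinfun_componentwise)
    fix i :: "real^2"
    show "continuous_on U (\<lambda>y. blinfun_apply (Blinfun (L y)) i)"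
      unfolding bl_apply unfolding L_def by (intro continuous_intros u(2) v(2))
  qed
  have "h = 0" if "L x h = 0" for h
    using orthogonal_basis_plane_eq_0[OF orth[OF \<open>x \<in> U\<close>] nz, of h] L_nth[of x h] that by simp
  then have "inj (L x)"
    using linear_injective_0[of "L x"] bl by (auto simp: bounded_linear.linear)
  then obtain G where "linear G" "G \<circ> L x = id"
    using linear_injective_left_inverse bl bounded_linear.linear by blast
  then have inv: "Blinfun G o\<^sub>L Blinfun (L x) = id_blinfun"
    by (intro blinfun_eqI)
      (simp add: bl_apply bounded_linear_Blinfun_apply linear_conv_bounded_linear fun_eq_iff)
  obtain U' V g g' where U': "open U'" "U' \<subseteq> U" "x \<in> U'" and V: "open V" "F x \<in> V"
    and hom: "homeomorphism U' V F g"
    and derg: "\<And>p. p \<in> V \<Longrightarrow> (g has_derivative g' p) (at p)"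
    and g': "\<And>p. p \<in> V \<Longrightarrow> g' p = inv (blinfun_apply (Blinfun (L (g p))))"
    and bij: "\<And>p. p \<in> V \<Longrightarrow> bij (blinfun_apply (Blinfun (L (g p))))"
    using inverse_function_theorem[OF \<open>open U\<close> derF contL \<open>x \<in> U\<close> inv] by blast
  obtain \<epsilon> where "0 < \<epsilon>" and \<epsilon>: "ball (F x) \<epsilon> \<subseteq> V"
    using V openE by blast
  have gF: "g (F y) = y" if "y \<in> U'" for y
    using hom that by (simp add: homeomorphism_def)
  have Fg: "F (g p) = p" "g p \<in> U'" if "p \<in> V" for p
    using hom that by (auto simp: homeomorphism_def)
  define c where "c = 2 * v x"
  have "0 < c"
    using nz(1) by (simp add: c_def vu)
  (* P is the uniform motion in the coordinates F, and c = |Du(x)|^2 is its speed; I consists of the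
     times that P spends in the ball. *)
  define P where "P = (\<lambda>t. F x + (c * t) *\<^sub>R ?e)"
  define I where "I = {- (\<epsilon> / c) <..< \<epsilon> / c}"
  define W where "W = U' \<inter> F -` ball (F x) \<epsilon>"
  have P_ball: "P t \<in> ball (F x) \<epsilon> \<longleftrightarrow> t \<in> I" for t
  proof -
    have "P t \<in> ball (F x) \<epsilon> \<longleftrightarrow> c * \<bar>t\<bar> < \<epsilon>"
      using \<open>0 < c\<close> by (simp add: P_def dist_norm abs_mult)
    also have "\<dots> \<longleftrightarrow> \<bar>t\<bar> < \<epsilon> / c"
      using \<open>0 < c\<close> by (simp add: field_simps)
    also have "\<dots> \<longleftrightarrow> t \<in> I"
      by (auto simp: I_def abs_less_iff)
    finally show ?thesis .
  qed
  have P_V: "P t \<in> V" if "t \<in> I" for t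
    using P_ball that \<epsilon> by blast
  have v_const: "v (g (P t)) = v x" if "t \<in> I" for t
    using Fg(1)[OF P_V[OF that]] F_nth(2)[of "g (P t)"] F_nth(2)[of x]
    by (simp add: P_def axis_def)
  show thesis
  proof
    have "continuous_on U' F"
      using hom by (simp add: homeomorphism_def)
    then show "open W"
      unfolding W_def using U'(1) by (intro continuous_open_preimage) auto
    show "x \<in> W" "W \<subseteq> U"
      using U' \<open>0 < \<epsilon>\<close> by (auto simp: W_def)
    show "0 \<in> I"
      using \<open>0 < \<epsilon>\<close> \<open>0 < c\<close> by (simp add: I_def)
    show "g (P 0) = x"
      by (simp add: P_def gF U')
    show "gradient_trajectory u U I (\<lambda>t. g (P t))"
      unfolding gradient_trajectory_def
    proof (intro conjI ballI)
      show "open I" "is_interval I"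
        by (simp_all add: I_def)
      fix t assume "t \<in> I"
      note p = P_V[OF \<open>t \<in> I\<close>]
      then show gU: "g (P t) \<in> U"
        using Fg(2) U'(2) by blast
      (* L is the derivative of F. Both L(Du) and L(d/dt g(P)) are the velocity of P, and L is
         injective. *)
      have "L (g (P t)) (gradient u (g (P t))) = c *\<^sub>R ?e"
        using v_const[OF \<open>t \<in> I\<close>] orth[OF gU]
        by (simp add: L_def c_def vu power2_norm_eq_inner inner_commute)
      then have g'e: "g' (P t) (c *\<^sub>R ?e) = gradient u (g (P t))"
        using g'[OF p] bij[OF p] by (metis bl_apply bij_is_inj inv_f_f)
      have "(P has_derivative (\<lambda>h. h *\<^sub>R c *\<^sub>R ?e)) (at t)"
        unfolding P_def by (auto intro!: derivative_eq_intros simp: mult.commute)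
      from has_derivative_compose[OF this derg[OF p]]
      have "((\<lambda>t. g (P t)) has_derivative (\<lambda>h. g' (P t) (h *\<^sub>R c *\<^sub>R ?e))) (at t)" .
      moreover have "linear (g' (P t))"
        using derg[OF p] has_derivative_linear by blast
      ultimately show "((\<lambda>t. g (P t)) has_vector_derivative gradient u (g (P t))) (at t)"
        by (simp only: has_vector_derivative_def linear_cmul[of "g' (P t)"] g'e)
    qed
    show "{y \<in> W. v y = v x} = (\<lambda>t. g (P t)) ` I"
    proof (intro equalityI subsetI)
      fix y assume "y \<in> {y \<in> W. v y = v x}"
      then have "y \<in> U'" "F y \<in> ball (F x) \<epsilon>" "v y = v x"
        by (auto simp: W_def)
      then have "F y = P ((u y - u x) / c)"
        using \<open>0 < c\<close> by (simp add: P_def vec_eq_iff forall_2 F_nth axis_def)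
      then show "y \<in> (\<lambda>t. g (P t)) ` I"
        using gF[OF \<open>y \<in> U'\<close>] \<open>F y \<in> _\<close> P_ball by (metis imageI)
    next
      fix y assume "y \<in> (\<lambda>t. g (P t)) ` I"
      then obtain t where "t \<in> I" "y = g (P t)"
        by blast
      then show "y \<in> {y \<in> W. v y = v x}"
        using Fg[OF P_V] P_ball v_const by (simp add: W_def)
    qed
  qed
qed

section \<open>Mean curvature of the level sets of \<open>|Du|\<^sup>2/2\<close>\<close>

theorem proposition4p2:
  fixes U :: "(real^2) set" and u v :: "real^2 \<Rightarrow> real"
  assumes "open U" and "connected U"
    and "C2_on U u" and "infinity_harmonic_on U u"
    and "\<And>x. x \<in> U \<Longrightarrow> gradient u x \<noteq> 0"
    and "\<And>x. x \<in> U \<Longrightarrow> det (hessian u x) \<noteq> 0"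
    and "v = (\<lambda>x. (norm (gradient u x))\<^sup>2 / 2)"
  shows "(\<forall>x\<in>U. v differentiable (at x) \<and> gradient v x \<noteq> 0 \<and>
            unit_normal v differentiable (at x) \<and>
            - divergence (\<lambda>y. gradient v y /\<^sub>R norm (gradient v y)) x
              = norm (gradient v x) / (2 * v x)) \<and>
         (\<forall>x\<in>U. level_set_mean_curvature v x
            = norm (hessian u x *v gradient u x) / (norm (gradient u x))\<^sup>2) \<and>
         (\<forall>x\<in>U. \<exists>W I \<gamma>. open W \<and> x \<in> W \<and> W \<subseteq> U \<and>
            gradient_trajectory u U I \<gamma> \<and> 0 \<in> I \<and> \<gamma> 0 = x \<and>
            {y\<in>W. v y = v x} = \<gamma> ` I) \<and>
         (\<forall>I \<gamma>. gradient_trajectory u U I \<gamma> \<longrightarrow>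
            (\<forall>s\<in>I. \<forall>t\<in>I. v (\<gamma> s) = v (\<gamma> t)) \<and>
            (\<forall>t\<in>I. unit_tangent \<gamma> differentiable (at t) \<and>
               curvature_vector \<gamma> t
                 = (norm (hessian u (\<gamma> t) *v gradient u (\<gamma> t)) / (norm (gradient u (\<gamma> t)))\<^sup>2)
                     *\<^sub>R unit_normal v (\<gamma> t)))"
proof -
  note Du = assms(5) and v = assms(7)
  have vu: "v y = (norm (gradient u y))\<^sup>2 / 2" for y
    by (simp add: v)
  have v_diff: "v differentiable (at x)" if "x \<in> U" for x
    unfolding v using has_derivative_half_norm_gradient[OF assms(1,3) that]
    by (auto simp: differentiable_def)
  have Dv_eq: "gradient v x = hessian u x *v gradient u x" if "x \<in> U" for x
    unfolding v using gradient_half_norm_gradient[OF assms(1,3) that] .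
  have Dv: "gradient v x \<noteq> 0" if "x \<in> U" for x
    unfolding Dv_eq[OF that]
    using Du[OF that] assms(6)[OF that]
    by (metis invertible_det_nz invertible_def matrix_left_invertible_ker)
  have orth: "gradient u x \<bullet> gradient v x = 0" if "x \<in> U" for x
    using infinity_harmonic_on_orthogonal[OF assms(4) that] Dv_eq[OF that] by simp
  have n: "unit_normal v differentiable (at x)"
    "divergence (unit_normal v) x = - (norm (gradient v x) / (norm (gradient u x))\<^sup>2)" if "x \<in> U" for x
    using unit_normal_divergence[OF assms(1,3,4) Du v Dv that] by blast+
  have level: "\<exists>W I \<gamma>. open W \<and> x \<in> W \<and> W \<subseteq> U \<and> gradient_trajectory u U I \<gamma> \<and> 0 \<in> I \<and> \<gamma> 0 = x \<and>
            {y\<in>W. v y = v x} = \<gamma> ` I" if xU: "x \<in> U" for x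
  proof -
    have "continuous_on U (\<lambda>y. hessian u y *v gradient u y)"
      by (rule continuous_on_matrix_vector_mult[OF C2_on_continuous_hessian C2_on_continuous_gradient, OF assms(3,3)])
    then have "continuous_on U (gradient v)"
      by (simp add: Dv_eq cong: continuous_on_cong)
    note cont = C2_on_continuous_gradient[OF assms(3)] this
    obtain W I \<gamma> where "open W" "x \<in> W" "W \<subseteq> U" "gradient_trajectory u U I \<gamma>" "0 \<in> I" "\<gamma> 0 = x"
        "{y\<in>W. v y = v x} = \<gamma> ` I"
      using level_set_local_gradient_trajectory[OF assms(1) xU C2_on_differentiable(1)[OF assms(3)]
          cont(1) v_diff cont(2) orth Du[OF xU] Dv[OF xU] vu] by blast
    then show ?thesis
      by blast
  qed
  have const: "v (\<gamma> s) = v (\<gamma> t)"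
    if "gradient_trajectory u U I \<gamma>" "s \<in> I" "t \<in> I" for I \<gamma> s t
    using gradient_trajectory_constant[OF that(1) v_diff _ that(2,3)] orth by (simp add: inner_commute)
  have speed: "norm (gradient u (\<gamma> s)) = norm (gradient u (\<gamma> t))"
    if "gradient_trajectory u U I \<gamma>" "s \<in> I" "t \<in> I" for I \<gamma> s t
    using const[OF that] unfolding v by simp
  have curvature: "unit_tangent \<gamma> differentiable (at t)"
    "curvature_vector \<gamma> t
      = (norm (hessian u (\<gamma> t) *v gradient u (\<gamma> t)) / (norm (gradient u (\<gamma> t)))\<^sup>2) *\<^sub>R unit_normal v (\<gamma> t)"
    if tr: "gradient_trajectory u U I \<gamma>" and "t \<in> I" for I \<gamma> t
  proof -
    have \<gamma>t: "\<gamma> t \<in> U"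
      using that by (simp add: gradient_trajectory_def)
    note curv = gradient_trajectory_curvature[OF tr assms(3) speed[OF tr] \<open>t \<in> I\<close>]
    show "unit_tangent \<gamma> differentiable (at t)"
      by (rule curv(1))
    have "curvature_vector \<gamma> t = gradient v (\<gamma> t) /\<^sub>R (norm (gradient u (\<gamma> t)))\<^sup>2"
      unfolding Dv_eq[OF \<gamma>t] by (rule curv(2))
    then show "curvature_vector \<gamma> t
        = (norm (hessian u (\<gamma> t) *v gradient u (\<gamma> t)) / (norm (gradient u (\<gamma> t)))\<^sup>2) *\<^sub>R unit_normal v (\<gamma> t)"
      using Dv[OF \<gamma>t] unfolding unit_normal_def Dv_eq[OF \<gamma>t, symmetric]
      by (simp add: divide_inverse)
  qed
  have div: "- divergence (\<lambda>y. gradient v y /\<^sub>R norm (gradient v y)) x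
      = norm (gradient v x) / (2 * v x)" if "x \<in> U" for x
    using n(2)[OF that] by (simp add: unit_normal_def[abs_def] vu)
  have mean: "level_set_mean_curvature v x = norm (hessian u x *v gradient u x) / (norm (gradient u x))\<^sup>2"
    if "x \<in> U" for x
    using n(2)[OF that] by (simp add: level_set_mean_curvature_def Dv_eq[OF that])
  show ?thesis
  proof (intro conjI ballI allI impI)
    fix I \<gamma> assume tr: "gradient_trajectory u U I \<gamma>"
    show "v (\<gamma> s) = v (\<gamma> t)" if "s \<in> I" "t \<in> I" for s t
      using const[OF tr that] .
    show "unit_tangent \<gamma> differentiable (at t)"
      "curvature_vector \<gamma> t
        = (norm (hessian u (\<gamma> t) *v gradient u (\<gamma> t)) / (norm (gradient u (\<gamma> t)))\<^sup>2)
            *\<^sub>R unit_normal v (\<gamma> t)" if "t \<in> I" for t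
      using curvature[OF tr that] .
  qed (rule v_diff Dv n(1) div mean level, assumption)+
qed

end
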